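(* Let $(V,E)$ be a Banach–Kantorovich space over an atomless Dedekind complete vector lattice $E$, and let $\Gamma$ be any set. Let $X=X(\Gamma)$ denote one of the Banach lattices $c_0(\Gamma)$ or $\ell_p(\Gamma)$ with $1\le p<\infty$. Then every order-to-norm continuous linear dominated operator $T:V\to X$ is narrow.
   Context: All vector spaces are real and all vector lattices are archimedean. A vector lattice $E$ is atomless if it has no atom, where an element $e>0$ is an atom if whenever $0\le f_1\le e$, $0\le f_2\le e$ and $f_1\perp f_2$, then $f_1=0$ or $f_2=0$. Lattice-normed space: Let $V$ be a vector space and $E$ a vector lattice. A vector norm is a map $|\cdot|_V:V\to E$ such that $|v|_V\ge 0$, $|v|_V=0\Leftrightarrow v=0$, $|v_1+v_2|_V\le |v_1|_V+|v_2|_V$ and $|\lambda v|_V=|\lambda|\,|v|_V$ for all $v,v_1,v_2\in V$, $\lambda\in\mathbb R$. The pair $(V,E)$ with such a norm is a lattice-normed space. It is decomposable if whenever $|x|_V=e_1+e_2$ with $e_1,e_2\in E_+$, there exist $x_1,x_2\in V$ with $x=x_1+x_2$ and $|x_k|_V=e_k$ for $k=1,2$. A net $(v_\alpha)_{\alpha\in\Delta}$ in $V$ $(bo)$-converges to $v\in V$ if there is a decreasing net $(e_\gamma)_{\gamma\in\Gamma'}$ in $E_+$ with $\inf_\gamma e_\gamma=0$ such that for every $\gamma$ there is $\alpha(\gamma)\in\Delta$ with $|v-v_\alpha|_V\le e_\gamma$ for all $\alpha\ge\alpha(\gamma)$. A net $(v_\alpha)_{\alpha\in\Delta}$ is $(bo)$-fundamental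 if the net $(v_\alpha-v_\beta)_{(\alpha,\beta)\in\Delta\times\Delta}$ $(bo)$-converges to $0$. $(V,E)$ is $(bo)$-complete if every $(bo)$-fundamental net $(bo)$-converges to an element of $V$. A Banach–Kantorovich space is a decomposable $(bo)$-complete lattice-normed space. Elements $x,y\in V$ are disjoint, $x\perp y$, if $|x|_V\wedge|y|_V=0$. An element $z\in V$ is a fragment of $x\in V$ if $|z|_V\le|x|_V$ and $z\perp(x-z)$. Two fragments $x_1,x_2$ of $x$ are mutually complemented (MC) if $x=x_1+x_2$. A vector lattice (in particular $X$) is regarded as a lattice-normed space over itself, with vector norm the modulus. A linear operator $T:V\to W$ between lattice-normed spaces $(V,E)$ and $(W,F)$ is dominated if there is a positive linear operator $S:E\to F$ with $|Tv|_W\le S|v|_V$ for all $v\in V$. A linear operator $T:V\to X$ into a Banach space $X$ is order-to-norm continuous if it sends $(bo)$-convergent nets in $V$ to norm convergent nets in $X$. It is narrow (with $E$ atomless) if for every $v\in V$ and $\varepsilon>0$ there exist MC fragments $v_1,v_2$ of $v$ such that $\|Tv_1-Tv_2\|<\varepsilon$. *)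

theory Defs
  imports "HOL-Analysis.Analysis" "HOL-Library.Function_Algebras"
begin

section \<open>Vector lattices\<close>

text \<open>
  A vector lattice is a type of sort \<open>{ordered_real_vector, lattice}\<close>; it is Dedekind complete
  (hence archimedean) when it is moreover of sort \<open>conditionally_complete_lattice\<close>.
\<close>

definition modulus :: "'e::{ordered_real_vector,lattice} \<Rightarrow> 'e" where
  "modulus x = sup x (- x)"

text \<open>Disjointness with respect to a vector norm; for \<open>nu = modulus\<close> this is the usual
  disjointness in a vector lattice.\<close>

definition disjoint_wrt :: "('v \<Rightarrow> 'e::{ordered_real_vector,lattice}) \<Rightarrow> 'v \<Rightarrow> 'v \<Rightarrow> bool" where
  "disjoint_wrt nu x y \<longleftrightarrow> inf (nu x) (nu y) = 0"

definition vl_atom :: "'e::{ordered_real_vector,lattice} \<Rightarrow> bool" where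
  "vl_atom e \<longleftrightarrow> 0 < e \<and>
     (\<forall>f1 f2. 0 \<le> f1 \<and> f1 \<le> e \<and> 0 \<le> f2 \<and> f2 \<le> e \<and> disjoint_wrt modulus f1 f2
        \<longrightarrow> f1 = 0 \<or> f2 = 0)"

definition atomless :: "'e::{ordered_real_vector,lattice} itself \<Rightarrow> bool" where
  "atomless _ \<longleftrightarrow> \<not> (\<exists>e::'e. vl_atom e)"


section \<open>Lattice-normed spaces\<close>

definition vector_norm ::
  "('v::real_vector \<Rightarrow> 'e::{ordered_real_vector,lattice}) \<Rightarrow> bool" where
  "vector_norm nu \<longleftrightarrow>
     (\<forall>v. 0 \<le> nu v) \<and> (\<forall>v. nu v = 0 \<longleftrightarrow> v = 0) \<and>
     (\<forall>v w. nu (v + w) \<le> nu v + nu w) \<and> (\<forall>r v. nu (r *\<^sub>R v) = \<bar>r\<bar> *\<^sub>R nu v)"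

definition decomposable ::
  "('v::real_vector \<Rightarrow> 'e::{ordered_real_vector,lattice}) \<Rightarrow> bool" where
  "decomposable nu \<longleftrightarrow>
     (\<forall>x e1 e2. 0 \<le> e1 \<and> 0 \<le> e2 \<and> nu x = e1 + e2
        \<longrightarrow> (\<exists>x1 x2. x = x1 + x2 \<and> nu x1 = e1 \<and> nu x2 = e2))"


section \<open>Nets and (bo)-convergence\<close>

text \<open>
  A net is a function on a directed preordered set \<open>D\<close>, with \<open>le a b\<close> meaning that \<open>b\<close> lies
  beyond \<open>a\<close>.
\<close>

definition directed_set :: "'i set \<Rightarrow> ('i \<Rightarrow> 'i \<Rightarrow> bool) \<Rightarrow> bool" where
  "directed_set D le \<longleftrightarrow> D \<noteq> {} \<and> reflp_on D le \<and> transp_on D le \<and>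
     (\<forall>a\<in>D. \<forall>b\<in>D. \<exists>c\<in>D. le a c \<and> le b c)"

definition decreasing_to_zero ::
  "'g set \<Rightarrow> ('g \<Rightarrow> 'g \<Rightarrow> bool) \<Rightarrow> ('g \<Rightarrow> 'e::{ordered_real_vector,lattice}) \<Rightarrow> bool" where
  "decreasing_to_zero G le e \<longleftrightarrow> directed_set G le \<and>
     (\<forall>i\<in>G. \<forall>j\<in>G. le i j \<longrightarrow> e j \<le> e i) \<and>
     (\<forall>i\<in>G. 0 \<le> e i) \<and> (\<forall>x. (\<forall>i\<in>G. x \<le> e i) \<longrightarrow> x \<le> 0)"

text \<open>
  HOL cannot quantify over the type of an index set inside a formula. The dominating net is
  therefore indexed by a subset of \<open>'e\<close>, and in the definitions of (bo)-completeness and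
  order-to-norm continuity the nets of vectors are indexed by subsets of \<open>'v set \<times> 'v\<close>. This is no
  restriction: see \<open>bo_convergesI\<close>, \<open>bo_completeD\<close> and \<open>order_to_norm_continuousD\<close> below, where
  the index types are arbitrary.
\<close>

definition bo_converges ::
  "('v::real_vector \<Rightarrow> 'e::{ordered_real_vector,lattice}) \<Rightarrow>
     'i set \<Rightarrow> ('i \<Rightarrow> 'i \<Rightarrow> bool) \<Rightarrow> ('i \<Rightarrow> 'v) \<Rightarrow> 'v \<Rightarrow> bool" where
  "bo_converges nu D le x v \<longleftrightarrow>
     (\<exists>(G::'e set) leG (e::'e \<Rightarrow> 'e). decreasing_to_zero G leG e \<and>
        (\<forall>c\<in>G. \<exists>a\<in>D. \<forall>b\<in>D. le a b \<longrightarrow> nu (v - x b) \<le> e c))"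

definition bo_fundamental ::
  "('v::real_vector \<Rightarrow> 'e::{ordered_real_vector,lattice}) \<Rightarrow>
     'i set \<Rightarrow> ('i \<Rightarrow> 'i \<Rightarrow> bool) \<Rightarrow> ('i \<Rightarrow> 'v) \<Rightarrow> bool" where
  "bo_fundamental nu D le x \<longleftrightarrow>
     bo_converges nu (D \<times> D) (rel_prod le le) (\<lambda>(a, b). x a - x b) 0"

definition bo_complete ::
  "('v::real_vector \<Rightarrow> 'e::{ordered_real_vector,lattice}) \<Rightarrow> bool" where
  "bo_complete nu \<longleftrightarrow>
     (\<forall>(D::('v set \<times> 'v) set) le x. directed_set D le \<and> bo_fundamental nu D le x
        \<longrightarrow> (\<exists>v. bo_converges nu D le x v))"

definition banach_kantorovich ::
  "('v::real_vector \<Rightarrow> 'e::{ordered_real_vector,lattice}) \<Rightarrow> bool" where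
  "banach_kantorovich nu \<longleftrightarrow> vector_norm nu \<and> decomposable nu \<and> bo_complete nu"


section \<open>Fragments and operators\<close>

definition fragment ::
  "('v::real_vector \<Rightarrow> 'e::{ordered_real_vector,lattice}) \<Rightarrow> 'v \<Rightarrow> 'v \<Rightarrow> bool" where
  "fragment nu z x \<longleftrightarrow> nu z \<le> nu x \<and> disjoint_wrt nu z (x - z)"

definition mc_fragments ::
  "('v::real_vector \<Rightarrow> 'e::{ordered_real_vector,lattice}) \<Rightarrow> 'v \<Rightarrow> 'v \<Rightarrow> 'v \<Rightarrow> bool" where
  "mc_fragments nu x x1 x2 \<longleftrightarrow> fragment nu x1 x \<and> fragment nu x2 x \<and> x = x1 + x2"

text \<open>
  In the following, the codomain of an operator is a subspace \<open>X\<close> (or a vector sublattice \<open>F\<close>) of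
  an ambient type, and \<open>nX\<close> is the norm of \<open>X\<close>.
\<close>

definition dominated ::
  "('v::real_vector \<Rightarrow> 'e::{ordered_real_vector,lattice}) \<Rightarrow>
     ('w::real_vector \<Rightarrow> 'f::{ordered_real_vector,lattice}) \<Rightarrow> 'f set \<Rightarrow> ('v \<Rightarrow> 'w) \<Rightarrow> bool" where
  "dominated nu mu F T \<longleftrightarrow>
     (\<exists>S::'e \<Rightarrow> 'f. linear S \<and> range S \<subseteq> F \<and> (\<forall>e\<ge>0. 0 \<le> S e) \<and>
        (\<forall>v. mu (T v) \<le> S (nu v)))"

definition net_norm_converges ::
  "('x::real_vector \<Rightarrow> real) \<Rightarrow> 'i set \<Rightarrow> ('i \<Rightarrow> 'i \<Rightarrow> bool) \<Rightarrow> ('i \<Rightarrow> 'x) \<Rightarrow> 'x \<Rightarrow> bool" where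
  "net_norm_converges nX D le y l \<longleftrightarrow>
     (\<forall>\<epsilon>>0. \<exists>a\<in>D. \<forall>b\<in>D. le a b \<longrightarrow> nX (y b - l) < \<epsilon>)"

definition order_to_norm_continuous ::
  "('v::real_vector \<Rightarrow> 'e::{ordered_real_vector,lattice}) \<Rightarrow>
     'x::real_vector set \<Rightarrow> ('x \<Rightarrow> real) \<Rightarrow> ('v \<Rightarrow> 'x) \<Rightarrow> bool" where
  "order_to_norm_continuous nu X nX T \<longleftrightarrow>
     (\<forall>(D::('v set \<times> 'v) set) le x v. directed_set D le \<and> bo_converges nu D le x v
        \<longrightarrow> (\<exists>l\<in>X. net_norm_converges nX D le (\<lambda>a. T (x a)) l))"

definition narrow ::
  "('v::real_vector \<Rightarrow> 'e::{ordered_real_vector,lattice}) \<Rightarrow>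
     ('x::real_vector \<Rightarrow> real) \<Rightarrow> ('v \<Rightarrow> 'x) \<Rightarrow> bool" where
  "narrow nu nX T \<longleftrightarrow>
     (\<forall>v. \<forall>\<epsilon>>0. \<exists>v1 v2. mc_fragments nu v v1 v2 \<and> nX (T v1 - T v2) < \<epsilon>)"


section \<open>Real-valued functions and the sequence spaces\<close>

instantiation "fun" :: (type, real_vector) real_vector
begin

definition scaleR_fun :: "real \<Rightarrow> ('a \<Rightarrow> 'b) \<Rightarrow> 'a \<Rightarrow> 'b" where
  "scaleR_fun r f = (\<lambda>t. r *\<^sub>R f t)"

instance
  by standard (auto simp: scaleR_fun_def fun_eq_iff scaleR_add_right scaleR_add_left)

end

instance "fun" :: (type, ordered_real_vector) ordered_real_vector
  by standard
    (auto simp: scaleR_fun_def le_fun_def intro: scaleR_left_mono scaleR_right_mono)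

text \<open>
  Elements of \<open>c\<^sub>0(\<Gamma>)\<close> and \<open>\<ell>\<^sub>p(\<Gamma>)\<close> are represented by functions on a type vanishing outside \<open>\<Gamma>\<close>,
  ordered pointwise. As they vanish there, the norms may be taken over the whole type, which makes
  the supremum norm correct for empty \<open>\<Gamma>\<close> as well.
\<close>

definition c0_space :: "'g set \<Rightarrow> ('g \<Rightarrow> real) set" where
  "c0_space \<Gamma> = {x. (\<forall>t. t \<notin> \<Gamma> \<longrightarrow> x t = 0) \<and> (\<forall>\<epsilon>>0. finite {t\<in>\<Gamma>. \<epsilon> \<le> \<bar>x t\<bar>})}"

definition c0_norm :: "('g \<Rightarrow> real) \<Rightarrow> real" where
  "c0_norm x = (SUP t. \<bar>x t\<bar>)"

definition lp_space :: "real \<Rightarrow> 'g set \<Rightarrow> ('g \<Rightarrow> real) set" where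
  "lp_space p \<Gamma> = {x. (\<forall>t. t \<notin> \<Gamma> \<longrightarrow> x t = 0) \<and> (\<lambda>t. \<bar>x t\<bar> powr p) summable_on \<Gamma>}"

definition lp_norm :: "real \<Rightarrow> ('g \<Rightarrow> real) \<Rightarrow> real" where
  "lp_norm p x = (\<Sum>\<^sub>\<infinity>t. \<bar>x t\<bar> powr p) powr (1 / p)"


section \<open>Independence of the index types\<close>

lemma bo_convergesI:
  fixes nu :: "'v::real_vector \<Rightarrow> 'e::{ordered_real_vector,lattice}" and e :: "'g \<Rightarrow> 'e"
  assumes e: "decreasing_to_zero G leG e"
    and dom: "\<forall>c\<in>G. \<exists>a\<in>D. \<forall>b\<in>D. le a b \<longrightarrow> nu (v - x b) \<le> e c"
  shows "bo_converges nu D le x v"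
proof -
  have ne: "G \<noteq> {}" and dir: "\<And>a b. a \<in> G \<Longrightarrow> b \<in> G \<Longrightarrow> \<exists>c\<in>G. leG a c \<and> leG b c"
    and dec: "\<And>i j. i \<in> G \<Longrightarrow> j \<in> G \<Longrightarrow> leG i j \<Longrightarrow> e j \<le> e i"
    using e unfolding decreasing_to_zero_def directed_set_def by auto
  have "\<exists>c\<in>e ` G. c \<le> y \<and> c \<le> z" if yz: "y \<in> e ` G" "z \<in> e ` G" for y z
  proof -
    obtain i j where ij: "i \<in> G" "y = e i" "j \<in> G" "z = e j" using yz by auto
    then obtain k where "k \<in> G" "leG i k" "leG j k" using dir by blast
    then show ?thesis using ij dec by blast
  qed
  then have "directed_set (e ` G) (\<lambda>y z. z \<le> y)"
    unfolding directed_set_def reflp_on_def transp_on_def using ne by (auto intro: order_trans)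
  then have "decreasing_to_zero (e ` G) (\<lambda>y z. z \<le> y) (\<lambda>y. y)"
    using e unfolding decreasing_to_zero_def by auto
  moreover have "\<forall>c\<in>e ` G. \<exists>a\<in>D. \<forall>b\<in>D. le a b \<longrightarrow> nu (v - x b) \<le> c"
    using dom by blast
  ultimately show ?thesis
    unfolding bo_converges_def by blast
qed

text \<open>The net of pairs of a tail of \<open>x\<close> and a value in it; it has the same tails as \<open>x\<close>.\<close>

definition tail :: "'i set \<Rightarrow> ('i \<Rightarrow> 'i \<Rightarrow> bool) \<Rightarrow> ('i \<Rightarrow> 'v) \<Rightarrow> 'i \<Rightarrow> 'v set" where
  "tail D le x a = x ` {b\<in>D. le a b}"

definition tail_index :: "'i set \<Rightarrow> ('i \<Rightarrow> 'i \<Rightarrow> bool) \<Rightarrow> ('i \<Rightarrow> 'v) \<Rightarrow> ('v set \<times> 'v) set" where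
  "tail_index D le x = {(A, y). (\<exists>a\<in>D. A = tail D le x a) \<and> y \<in> A}"

definition tail_le :: "'v set \<times> 'v \<Rightarrow> 'v set \<times> 'v \<Rightarrow> bool" where
  "tail_le p q \<longleftrightarrow> fst q \<subseteq> fst p"

lemma tail_memI:
  assumes "directed_set D le" "a \<in> D"
  shows "(tail D le x a, x a) \<in> tail_index D le x"
  using assms unfolding directed_set_def tail_index_def tail_def reflp_on_def by auto

lemma directed_tail_index:
  assumes D: "directed_set D le"
  shows "directed_set (tail_index D le x) tail_le"
proof -
  have "tail_index D le x \<noteq> {}"
    using D tail_memI[OF D, of _ x] unfolding directed_set_def by blast
  moreover have "\<exists>r\<in>tail_index D le x. tail_le p r \<and> tail_le q r"
    if pq: "p \<in> tail_index D le x" "q \<in> tail_index D le x" for p q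
  proof -
    obtain a b where ab: "a \<in> D" "fst p = tail D le x a" "b \<in> D" "fst q = tail D le x b"
      using pq unfolding tail_index_def by auto
    then obtain c where c: "c \<in> D" "le a c" "le b c"
      using D unfolding directed_set_def by blast
    then have "tail D le x c \<subseteq> tail D le x a" "tail D le x c \<subseteq> tail D le x b"
      using D ab unfolding directed_set_def tail_def by (auto dest: transp_onD)
    then show ?thesis
      using tail_memI[OF D c(1), of x] ab unfolding tail_le_def by (metis fst_conv)
  qed
  ultimately show ?thesis
    unfolding directed_set_def reflp_on_def transp_on_def by (auto simp: tail_le_def)
qed

lemma ex_eventually_tail_index_iff:
  assumes D: "directed_set D le"
  shows "(\<exists>p\<in>tail_index D le x. \<forall>q\<in>tail_index D le x. tail_le p q \<longrightarrow> P (snd q))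
     \<longleftrightarrow> (\<exists>a\<in>D. \<forall>b\<in>D. le a b \<longrightarrow> P (x b))" (is "?L \<longleftrightarrow> ?R")
proof
  assume ?L
  then obtain p where p: "p \<in> tail_index D le x"
    and P: "\<And>q. q \<in> tail_index D le x \<Longrightarrow> tail_le p q \<Longrightarrow> P (snd q)" by blast
  obtain a where a: "a \<in> D" "fst p = tail D le x a"
    using p unfolding tail_index_def by auto
  have "P (x b)" if "b \<in> D" "le a b" for b
    using P[of "(tail D le x a, x b)"] a that
    unfolding tail_index_def tail_le_def tail_def by auto
  then show ?R using a by blast
next
  assume ?R
  then obtain a where a: "a \<in> D" "\<And>b. b \<in> D \<Longrightarrow> le a b \<Longrightarrow> P (x b)" by blast
  have "P (snd q)" if "q \<in> tail_index D le x" "tail_le (tail D le x a, x a) q" for q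
  proof -
    have "snd q \<in> tail D le x a"
      using that unfolding tail_index_def tail_le_def by auto
    then show ?thesis using a(2) unfolding tail_def by auto
  qed
  then show ?L using tail_memI[OF D a(1), of x] by blast
qed

lemma bo_converges_tail_index_iff:
  assumes "directed_set D le"
  shows "bo_converges nu (tail_index D le x) tail_le snd v \<longleftrightarrow> bo_converges nu D le x v"
  unfolding bo_converges_def
  using ex_eventually_tail_index_iff[OF assms, of x "\<lambda>y. nu (v - y) \<le> _"] by simp

lemma bo_fundamental_tail_index:
  fixes nu :: "'v::real_vector \<Rightarrow> 'e::{ordered_real_vector,lattice}"
  assumes D: "directed_set D le" and fund: "bo_fundamental nu D le x"
  shows "bo_fundamental nu (tail_index D le x) tail_le snd"
proof -
  obtain G leG and e :: "'e \<Rightarrow> 'e" where e: "decreasing_to_zero G leG e"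
    and dom: "\<forall>c\<in>G. \<exists>a\<in>D \<times> D. \<forall>b\<in>D \<times> D. rel_prod le le a b
                \<longrightarrow> nu (0 - (case b of (a, b) \<Rightarrow> x a - x b)) \<le> e c"
    using fund unfolding bo_fundamental_def bo_converges_def by blast
  have "\<exists>p\<in>tail_index D le x \<times> tail_index D le x. \<forall>q\<in>tail_index D le x \<times> tail_index D le x.
          rel_prod tail_le tail_le p q
          \<longrightarrow> nu (0 - (case q of (a, b) \<Rightarrow> snd a - snd b)) \<le> e c"
    if "c \<in> G" for c
  proof -
    obtain a1 a2 where a: "a1 \<in> D" "a2 \<in> D"
      and b: "\<And>b1 b2. b1 \<in> D \<Longrightarrow> b2 \<in> D \<Longrightarrow> le a1 b1 \<Longrightarrow> le a2 b2
                \<Longrightarrow> nu (0 - (x b1 - x b2)) \<le> e c"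
      using dom \<open>c \<in> G\<close> by fastforce
    have mem: "\<exists>b\<in>D. le a b \<and> snd q = x b"
      if "q \<in> tail_index D le x" "tail_le (tail D le x a, x a) q" for q a
    proof -
      have "snd q \<in> tail D le x a"
        using that unfolding tail_index_def tail_le_def by auto
      then show ?thesis unfolding tail_def by auto
    qed
    show ?thesis
    proof (rule bexI[of _ "((tail D le x a1, x a1), (tail D le x a2, x a2))"])
      show "((tail D le x a1, x a1), (tail D le x a2, x a2))
              \<in> tail_index D le x \<times> tail_index D le x"
        using tail_memI[OF D] a by blast
      show "\<forall>q\<in>tail_index D le x \<times> tail_index D le x.
          rel_prod tail_le tail_le ((tail D le x a1, x a1), (tail D le x a2, x a2)) q
          \<longrightarrow> nu (0 - (case q of (a, b) \<Rightarrow> snd a - snd b)) \<le> e c"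
      proof (intro ballI impI)
        fix q
        assume q: "q \<in> tail_index D le x \<times> tail_index D le x"
          and le: "rel_prod tail_le tail_le ((tail D le x a1, x a1), (tail D le x a2, x a2)) q"
        obtain q1 q2 where q12: "q = (q1, q2)" by (cases q)
        obtain b1 where b1: "b1 \<in> D" "le a1 b1" "snd q1 = x b1"
          using mem[of q1 a1] q le unfolding q12 by auto
        obtain b2 where b2: "b2 \<in> D" "le a2 b2" "snd q2 = x b2"
          using mem[of q2 a2] q le unfolding q12 by auto
        show "nu (0 - (case q of (a, b) \<Rightarrow> snd a - snd b)) \<le> e c"
          using b[OF b1(1) b2(1) b1(2) b2(2)] b1(3) b2(3) unfolding q12 by simp
      qed
    qed
  qed
  then show ?thesis
    unfolding bo_fundamental_def by (intro bo_convergesI[OF e]) blast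
qed

lemma bo_completeD:
  fixes D :: "'i set"
  assumes "bo_complete nu" "directed_set D le" "bo_fundamental nu D le x"
  shows "\<exists>v. bo_converges nu D le x v"
  using assms(1) directed_tail_index[OF assms(2), of x]
    bo_fundamental_tail_index[OF assms(2,3)] bo_converges_tail_index_iff[OF assms(2)]
  unfolding bo_complete_def by blast

lemma order_to_norm_continuousD:
  fixes D :: "'i set"
  assumes "order_to_norm_continuous nu X nX T" "directed_set D le" "bo_converges nu D le x v"
  shows "\<exists>l\<in>X. net_norm_converges nX D le (\<lambda>a. T (x a)) l"
proof -
  obtain l where l: "l \<in> X"
    "net_norm_converges nX (tail_index D le x) tail_le (\<lambda>p. T (snd p)) l"
    using assms(1,3) directed_tail_index[OF assms(2), of x]
      bo_converges_tail_index_iff[OF assms(2)]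
    unfolding order_to_norm_continuous_def by blast
  then show ?thesis
    using ex_eventually_tail_index_iff[OF assms(2), of x "\<lambda>y. nX (T y - l) < _"]
    unfolding net_norm_converges_def by auto
qed

end

theory Submission
  imports Defs
begin

text \<open>
  Fix \<open>v\<close> and let \<open>S\<close> be a positive operator with \<open>|T x| \<le> S (nu x)\<close>. If \<open>v = a + b\<close> with mutually
  complemented fragments \<open>a\<close>, \<open>b\<close>, then \<open>nu (a - b) \<le> nu v\<close>, so the function \<open>T a - T b\<close> lies below
  the fixed element \<open>S (nu v)\<close> of \<open>c\<^sub>0(\<Gamma>)\<close> or \<open>\<ell>\<^sub>p(\<Gamma>)\<close>. Outside a finite set \<open>F\<close> of coordinates
  that element is small in norm (\<open>c0_norm_small\<close>, \<open>lp_norm_small\<close>). Hence the theorem reduces to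
  finitely many functionals \<open>f\<^sub>t = (T \<sqdot>) t\<close>: some splitting of \<open>v\<close> must make every
  \<open>f\<^sub>t (a - b)\<close>, \<open>t \<in> F\<close>, small. This approximate form of Lyapunov's convexity theorem is
  \<open>balanced_fragments\<close>, proved by induction on \<open>F\<close>.

  In the step from \<open>F\<close> to \<open>F \<union> {t\<^sub>0}\<close> the vector \<open>v\<close> is cut into disjoint pieces. As the lattice is atomless,
  repeated halving gives below each nonzero component of \<open>nu v\<close> a nonzero component on which the
  positive functional \<open>e \<mapsto> (S e) t\<^sub>0\<close> is as small as desired (\<open>component_small\<close>); by Zorn's lemma
  and Dedekind completeness a disjoint family of such components exhausts \<open>nu v\<close>
  (\<open>component_exhaustion\<close>). Finitely many of them, with a remainder, give pieces of \<open>v\<close> by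
  decomposability. Each piece is split by the induction hypothesis so that its two halves
  almost agree on \<open>F\<close>. Which half goes to which side does not matter on \<open>F\<close>, and for the single
  functional \<open>f\<^sub>t\<^sub>0\<close> a greedy choice keeps the total difference as small as that of one piece
  (\<open>balanced_sum\<close>).

  The remainder needs a different argument, because \<open>S\<close> need not be order continuous and so may be
  large on it. But \<open>T\<close> is order-to-norm continuous: the difference of the two halves of the
  remainder is dominated by the norm of the remainder, which decreases to \<open>0\<close> as more components are
  used, so its image under \<open>f\<^sub>t\<^sub>0\<close> is small at some stage.
\<close>

section \<open>Components of a positive element\<close>

lemma disjoint_add_le:
  fixes x y z :: "'e::{ordered_real_vector,lattice}"
  assumes "inf x y = 0" "x \<le> z" "y \<le> z"
  shows "x + y \<le> z"
proof -
  have "x + y - z \<le> x" "x + y - z \<le> y"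
    using assms(2,3) by (simp_all add: algebra_simps)
  then have "x + y - z \<le> inf x y" by simp
  then show ?thesis using assms(1) by simp
qed

lemma disjoint_mono:
  fixes x y :: "'e::{ordered_real_vector,lattice}"
  assumes "inf x' y' = 0" "0 \<le> x" "x \<le> x'" "0 \<le> y" "y \<le> y'"
  shows "inf x y = 0"
proof (rule antisym)
  show "inf x y \<le> 0" using assms inf_mono[of x x' y y'] by simp
qed (use assms in simp)

lemma disjoint_add:
  fixes a b c :: "'e::{ordered_real_vector,lattice}"
  assumes "inf a c = 0" "inf b c = 0"
  shows "inf (a + b) c = 0"
proof -
  have pos: "0 \<le> a" "0 \<le> b" "0 \<le> c" using assms by (metis inf_le1 inf_le2)+
  let ?w = "inf (a + b) c"
  have "?w - b \<le> a" by (simp add: diff_le_eq)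
  moreover have "?w - b \<le> c"
    using add_mono[OF inf_le2[of "a + b" c] pos(2)] by (simp add: diff_le_eq)
  ultimately have "?w - b \<le> inf a c" by simp
  then have "?w \<le> b" using assms(1) by simp
  then have "?w \<le> inf b c" by simp
  then have "?w \<le> 0" using assms(2) by simp
  then show ?thesis using pos by (simp add: order_antisym)
qed

lemma disjoint_sum:
  fixes f :: "'i \<Rightarrow> 'e::{ordered_real_vector,lattice}"
  assumes "0 \<le> c" "\<And>i. i \<in> J \<Longrightarrow> inf (f i) c = 0"
  shows "inf (sum f J) c = 0"
  using assms(2)
proof (induction J rule: infinite_finite_induct)
  case (insert i J)
  then show ?case using disjoint_add[of "f i" c "sum f J"] by simp
qed (use assms(1) in \<open>simp_all add: inf_absorb1\<close>)

text \<open>A sum of pairwise disjoint positive elements is their supremum, hence at most any upper bound.\<close>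

lemma disjoint_sum_le:
  fixes f :: "'i \<Rightarrow> 'e::{ordered_real_vector,lattice}"
  assumes "0 \<le> z" "\<And>i. i \<in> J \<Longrightarrow> 0 \<le> f i" "\<And>i. i \<in> J \<Longrightarrow> f i \<le> z"
    and "pairwise (\<lambda>i j. inf (f i) (f j) = 0) J"
  shows "sum f J \<le> z"
  using assms(2-)
proof (induction J rule: infinite_finite_induct)
  case (insert i J)
  have "inf (sum f J) (f i) = 0"
    using insert by (intro disjoint_sum) (auto simp: pairwise_insert)
  moreover have "sum f J \<le> z" using insert by (simp add: pairwise_insert)
  ultimately have "sum f J + f i \<le> z" using insert.prems by (intro disjoint_add_le) auto
  then show ?case using insert by (simp add: add.commute)
qed (use assms(1) in auto)

definition component :: "'e::{ordered_real_vector,lattice} \<Rightarrow> 'e \<Rightarrow> bool" where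
  "component d e \<longleftrightarrow> 0 \<le> d \<and> d \<le> e \<and> inf d (e - d) = 0"

lemma component_refl: "0 \<le> e \<Longrightarrow> component e e"
  by (simp add: component_def inf_absorb2)

lemma component_diff: "component d e \<Longrightarrow> component (e - d) e"
  by (simp add: component_def inf_commute)

lemma component_trans:
  assumes "component d c" "component c e"
  shows "component d e"
proof -
  have "inf (c - d) d = 0" using assms(1) by (simp add: component_def inf_commute)
  moreover have "inf (e - c) d = 0"
    using assms disjoint_mono[of c "e - c" d "e - c"] by (simp add: component_def inf_commute)
  ultimately have "inf ((c - d) + (e - c)) d = 0" by (rule disjoint_add)
  then show ?thesis using assms order_trans[of d c e] by (simp add: component_def inf_commute)
qed

text \<open>
  Failing to be an atom only yields disjoint nonzero elements \<open>f\<close>, \<open>g\<close> below \<open>e\<close>, which need not be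
  components. The supremum \<open>d\<close> of all elements of \<open>[0, e]\<close> disjoint from \<open>g\<close>, which is the projection
  of \<open>e\<close> onto the disjoint complement of \<open>g\<close>, is a component; it is nonzero because \<open>f \<le> d\<close>, and
  different from \<open>e\<close> because it is disjoint from \<open>g\<close>.
\<close>

lemma component_split:
  fixes e :: "'e::{ordered_real_vector,conditionally_complete_lattice}"
  assumes "atomless TYPE('e)" "0 < e"
  shows "\<exists>d. component d e \<and> 0 < d \<and> d < e"
proof -
  obtain f g where fg: "0 \<le> f" "f \<le> e" "0 \<le> g" "g \<le> e" "disjoint_wrt modulus f g" "f \<noteq> 0" "g \<noteq> 0"
    using assms unfolding atomless_def vl_atom_def by blast
  have "modulus f = f" "modulus g = g"
    using fg by (simp_all add: modulus_def sup_absorb1 order_trans[of _ 0])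
  then have disj: "inf f g = 0" using fg by (simp add: disjoint_wrt_def)
  define A where "A = {x. 0 \<le> x \<and> x \<le> e \<and> inf x g = 0}"
  define d where "d = Sup A"
  have f: "f \<in> A" using fg disj by (simp add: A_def)
  have bdd: "bdd_above A" unfolding A_def by (rule bdd_aboveI[of _ e]) simp
  have upper: "x \<le> d" if "x \<in> A" for x unfolding d_def using that bdd by (rule cSup_upper)
  have least: "d \<le> z" if "\<And>x. x \<in> A \<Longrightarrow> x \<le> z" for z
    unfolding d_def using f that by (intro cSup_least) auto
  have d_pos: "0 < d"
    using order_less_le_trans[OF _ upper[OF f]] fg by (simp add: order_less_le)
  have d_le: "d \<le> e" by (rule least) (simp add: A_def)
  \<comment> \<open>Suprema preserve disjointness: \<open>d - inf d g\<close> is still an upper bound of \<open>A\<close>.\<close>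
  have dg: "inf d g = 0"
  proof -
    let ?w = "inf d g"
    have w0: "0 \<le> ?w" using d_pos fg by simp
    have "x \<le> d - ?w" if "x \<in> A" for x
    proof -
      have "inf x ?w = 0"
        using that w0 disjoint_mono[of x g x ?w] by (simp add: A_def)
      then have "x + ?w \<le> d" using upper[OF that] by (intro disjoint_add_le) auto
      then show ?thesis by (simp add: le_diff_eq)
    qed
    then have "d \<le> d - ?w" by (rule least)
    then show ?thesis using w0 by (simp add: order_antisym)
  qed
  \<comment> \<open>Otherwise \<open>d + inf d (e - d)\<close> would be a larger element of \<open>A\<close>.\<close>
  have "component d e"
  proof -
    let ?w = "inf d (e - d)"
    have w0: "0 \<le> ?w" using d_pos d_le by simp
    have "inf ?w g = 0" using dg w0 fg disjoint_mono[of d g ?w g] by simp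
    with dg have "inf (d + ?w) g = 0" by (rule disjoint_add)
    moreover have "d + ?w \<le> e" using inf_le2[of d "e - d"] by (simp add: le_diff_eq add.commute)
    ultimately have "d + ?w \<in> A" using w0 d_pos by (simp add: A_def)
    then have "d + ?w \<le> d" by (rule upper)
    then show ?thesis using w0 d_pos d_le by (simp add: component_def order_antisym)
  qed
  moreover have "d \<noteq> e" using dg fg by (auto simp: inf_absorb2)
  ultimately show ?thesis using d_pos d_le by auto
qed

text \<open>Of two complementary components, one carries at most half of an additive positive functional.\<close>

lemma component_small:
  fixes e :: "'e::{ordered_real_vector,conditionally_complete_lattice}"
  assumes "atomless TYPE('e)" "0 < e"
    and s: "linear s" "\<And>x. 0 \<le> x \<Longrightarrow> 0 \<le> s x" and "0 < \<delta>"
  shows "\<exists>d. component d e \<and> 0 < d \<and> s d \<le> (\<delta>::real)"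
proof -
  have "\<exists>d. component d e \<and> 0 < d \<and> s d \<le> s e / 2 ^ n" for n
  proof (induction n)
    case 0
    then show ?case using assms(2) component_refl[of e] by (intro exI[of _ e]) (simp add: order_less_imp_le)
  next
    case (Suc n)
    then obtain c where c: "component c e" "0 < c" "s c \<le> s e / 2 ^ n" by blast
    obtain d where d: "component d c" "0 < d" "d < c"
      using component_split[OF assms(1) c(2)] by blast
    have "s c = s d + s (c - d)" using linear_diff[OF s(1)] by simp
    then have "s d \<le> s c / 2 \<or> s (c - d) \<le> s c / 2" by linarith
    then obtain d' where "component d' c" "0 < d'" "s d' \<le> s c / 2"
      using d component_diff[OF d(1)] by (metis diff_gt_0_iff_gt)
    then show ?case using c component_trans[of d' c e] by (intro exI[of _ d']) auto
  qed
  moreover obtain n where "s e / \<delta> < 2 ^ n" using real_arch_pow[of 2 "s e / \<delta>"] by auto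
  then have "s e / 2 ^ n \<le> \<delta>" using \<open>0 < \<delta>\<close> by (simp add: field_simps)
  ultimately show ?thesis by (meson order_trans)
qed

text \<open>
  A maximal disjoint family of components with property \<open>P\<close> exhausts \<open>e\<close>. The infimum \<open>u\<close> of the
  remainders is itself a component of \<open>e\<close> disjoint from the whole family, so if it were nonzero, a
  component of \<open>u\<close> with property \<open>P\<close> could be added to the family.
\<close>

lemma component_exhaustion:
  fixes e :: "'e::{ordered_real_vector,conditionally_complete_lattice}"
  assumes e: "0 \<le> e"
    and dense: "\<And>u. component u e \<Longrightarrow> 0 < u \<Longrightarrow> \<exists>d. component d u \<and> 0 < d \<and> P d"
  obtains A where "\<And>d. d \<in> A \<Longrightarrow> component d e \<and> P d"
    and "pairwise (\<lambda>c d. inf c d = 0) A"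
    and "decreasing_to_zero {J. finite J \<and> J \<subseteq> A} (\<subseteq>) (\<lambda>J. e - \<Sum>J)"
proof -
  let ?Q = "\<lambda>A. (\<forall>d\<in>A. component d e \<and> P d) \<and> pairwise (\<lambda>c d. inf c d = 0) A"
  have "\<exists>A\<in>Collect ?Q. \<forall>B\<in>Collect ?Q. A \<subseteq> B \<longrightarrow> B = A"
  proof (rule subset_Zorn')
    fix C assume C: "subset.chain (Collect ?Q) C"
    have "pairwise (\<lambda>c d. inf c d = 0) (\<Union>C)"
    proof (rule pairwiseI)
      fix c d assume "c \<in> \<Union>C" "d \<in> \<Union>C" "c \<noteq> d"
      then obtain A B where "A \<in> C" "c \<in> A" "B \<in> C" "d \<in> B" by blast
      moreover from this have "A \<subseteq> B \<or> B \<subseteq> A" using C unfolding subset.chain_def by blast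
      ultimately obtain D where "D \<in> C" "c \<in> D" "d \<in> D" by blast
      moreover from this have "?Q D" using C unfolding subset.chain_def by blast
      ultimately show "inf c d = 0" using \<open>c \<noteq> d\<close> by (auto simp: pairwise_def)
    qed
    then show "\<Union>C \<in> Collect ?Q" using C unfolding subset.chain_def by blast
  qed
  then obtain A where "A \<in> Collect ?Q" and max': "\<forall>B\<in>Collect ?Q. A \<subseteq> B \<longrightarrow> B = A" by (elim bexE)
  then have A: "\<And>d. d \<in> A \<Longrightarrow> component d e \<and> P d" "pairwise (\<lambda>c d. inf c d = 0) A"
    by simp_all
  have max: "B = A" if "?Q B" "A \<subseteq> B" for B using max' that by simp
  let ?G = "{J. finite J \<and> J \<subseteq> A}" and ?r = "\<lambda>J. e - \<Sum>J"
  have comp: "0 \<le> d" "d \<le> e" "inf d (e - d) = 0" if "d \<in> A" for d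
    using A(1)[OF that] by (auto simp: component_def)
  have rest_pos: "0 \<le> ?r J" if "J \<subseteq> A" for J
  proof -
    have "(\<Sum>d\<in>J. d) \<le> e"
      using e comp that A(2) by (intro disjoint_sum_le) (auto intro: pairwise_mono)
    then show ?thesis by simp
  qed
  have rest_le: "?r J \<le> e - d" if "J \<subseteq> A" "finite J" "d \<in> J" for J d
    using sum_mono2[of J "{d}" "\<lambda>x. x"] comp that by (auto intro: diff_left_mono)
  define u where "u = Inf (?r ` ?G)"
  have bdd: "bdd_below (?r ` ?G)" using rest_pos by (intro bdd_belowI[of _ 0]) auto
  have lower: "u \<le> ?r J" if "J \<in> ?G" for J
    unfolding u_def using that bdd by (intro cInf_lower) auto
  have greatest: "z \<le> u" if "\<And>J. J \<in> ?G \<Longrightarrow> z \<le> ?r J" for z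
    unfolding u_def using that by (intro cInf_greatest) auto
  have u0: "0 \<le> u" using rest_pos by (intro greatest) auto
  have ue: "u \<le> e" using lower[of "{}"] by simp
  have u_disj: "inf d u = 0" if "d \<in> A" for d
    using disjoint_mono[OF comp(3)[OF that], of d u] comp[OF that] u0 lower[of "{d}"] that by simp
  \<comment> \<open>Otherwise \<open>u + inf u (e - u)\<close> would be a larger lower bound of the remainders.\<close>
  have "component u e"
  proof -
    let ?w = "inf u (e - u)"
    have w0: "0 \<le> ?w" using u0 ue by simp
    have "u + ?w \<le> ?r J" if J: "J \<in> ?G" for J
    proof -
      have "inf (\<Sum>J) ?w = 0"
      proof (rule disjoint_sum[OF w0])
        show "inf d ?w = 0" if "d \<in> J" for d
        proof -
          have d: "d \<in> A" using that J by blast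
          show ?thesis
            by (rule disjoint_mono[OF u_disj[OF d] comp(1)[OF d] order_refl w0 inf_le1])
        qed
      qed
      moreover have "\<Sum>J \<le> e - u" using lower[OF J] by (simp add: le_diff_eq add.commute)
      ultimately have "\<Sum>J + ?w \<le> e - u" by (intro disjoint_add_le) auto
      then show ?thesis by (simp add: algebra_simps)
    qed
    then have "u + ?w \<le> u" by (rule greatest)
    then show ?thesis using w0 u0 ue by (simp add: component_def order_antisym)
  qed
  have "u = 0"
  proof (rule ccontr)
    assume "u \<noteq> 0"
    then obtain d where d: "component d u" "0 < d" "P d"
      using dense \<open>component u e\<close> u0 by (metis order_less_le)
    have "inf c d = 0" if "c \<in> A" for c
      using d(1) disjoint_mono[OF u_disj[OF that] comp(1)[OF that] order_refl, of d]
      by (simp add: component_def)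
    moreover have "component d e" using d(1) \<open>component u e\<close> by (rule component_trans)
    ultimately have "?Q (insert d A)"
      using A d(3) by (auto simp: pairwise_insert inf_commute)
    then have "d \<in> A" using max by blast
    then have "inf d d = 0" using \<open>\<And>c. c \<in> A \<Longrightarrow> inf c d = 0\<close> by blast
    then show False using d(2) by simp
  qed
  have "decreasing_to_zero ?G (\<subseteq>) ?r"
    unfolding decreasing_to_zero_def
  proof (intro conjI allI ballI impI)
    have "\<exists>c\<in>?G. a \<subseteq> c \<and> b \<subseteq> c" if "a \<in> ?G" "b \<in> ?G" for a b
      using that by (intro bexI[of _ "a \<union> b"]) auto
    then show "directed_set ?G (\<subseteq>)"
      unfolding directed_set_def reflp_on_def transp_on_def by blast
    show "?r j \<le> ?r i" if "i \<in> ?G" "j \<in> ?G" "i \<subseteq> j" for i j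
      using that comp by (intro diff_left_mono sum_mono2) auto
    show "0 \<le> ?r i" if "i \<in> ?G" for i using rest_pos that by blast
    show "x \<le> 0" if "\<forall>i\<in>?G. x \<le> ?r i" for x
      using greatest that \<open>u = 0\<close> by blast
  qed
  with A show thesis by (intro that) auto
qed

section \<open>Disjoint decompositions in a lattice-normed space\<close>

text \<open>
  Disjointness of the summands alone forces \<open>nu a \<le> nu (a + b)\<close>: the difference lies below both
  \<open>nu a\<close> and \<open>nu b\<close>.
\<close>

lemma mc_fragmentsI:
  assumes "vector_norm nu" "inf (nu a) (nu b) = 0"
  shows "mc_fragments nu (a + b) a b"
proof -
  have nn: "0 \<le> nu x" "nu (x + y) \<le> nu x + nu y" "nu (r *\<^sub>R x) = \<bar>r\<bar> *\<^sub>R nu x" for x y r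
    using assms(1) unfolding vector_norm_def by auto
  have frag: "nu a \<le> nu (a + b)" if "inf (nu a) (nu b) = 0" for a b
  proof -
    have "nu a - nu (a + b) \<le> nu b"
      using nn(2)[of "a + b" "- b"] nn(3)[of "- 1" b] by (simp add: diff_le_eq add.commute)
    moreover have "nu a - nu (a + b) \<le> nu a" using nn(1)[of "a + b"] by (simp add: diff_le_eq)
    ultimately have "nu a - nu (a + b) \<le> inf (nu a) (nu b)" by simp
    then show ?thesis using that by simp
  qed
  show ?thesis
    using frag[of a b] frag[of b a] assms(2)
    unfolding mc_fragments_def fragment_def disjoint_wrt_def
    by (simp add: inf_commute add.commute)
qed

lemma mc_fragments_swap: "mc_fragments nu v a b \<Longrightarrow> mc_fragments nu v b a"
  by (auto simp: mc_fragments_def add.commute)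

lemma mc_fragments_disjoint: "mc_fragments nu v a b \<Longrightarrow> inf (nu a) (nu b) = 0"
  by (auto simp: mc_fragments_def fragment_def disjoint_wrt_def)

lemma vector_norm_diff_le:
  assumes "vector_norm nu"
  shows "nu (x - y) \<le> nu x + nu y"
proof -
  have "nu (x + - y) \<le> nu x + nu (- y)" "nu ((- 1) *\<^sub>R y) = \<bar>- 1\<bar> *\<^sub>R nu y"
    using assms unfolding vector_norm_def by blast+
  then show ?thesis by simp
qed

lemma vector_norm_zero: "vector_norm nu \<Longrightarrow> nu 0 = 0"
  unfolding vector_norm_def by blast

lemma vector_norm_sum_le:
  assumes "vector_norm nu"
  shows "nu (sum w J) \<le> (\<Sum>i\<in>J. nu (w i))"
proof (induction J rule: infinite_finite_induct)
  case (insert i J)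
  have "nu (w i + sum w J) \<le> nu (w i) + nu (sum w J)" using assms unfolding vector_norm_def by blast
  also have "\<dots> \<le> nu (w i) + (\<Sum>i\<in>J. nu (w i))" using insert.IH by simp
  finally show ?case using insert by simp
qed (simp_all add: vector_norm_zero[OF assms])

text \<open>
  The disjoint elements \<open>nu a\<close> and \<open>nu b\<close> both lie below \<open>nu v\<close>, hence so does their sum. This bound
  controls the difference of any splitting of \<open>v\<close>, however it was chosen.
\<close>

lemma mc_fragments_diff_le:
  assumes "vector_norm nu" "mc_fragments nu v a b"
  shows "nu (a - b) \<le> nu v"
proof -
  have "nu a + nu b \<le> nu v"
    using assms(2) mc_fragments_disjoint[OF assms(2)]
    by (intro disjoint_add_le) (auto simp: mc_fragments_def fragment_def)
  then show ?thesis using vector_norm_diff_le[OF assms(1), of a b] by (rule order_trans[rotated])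
qed

lemma mc_fragments_add:
  assumes nu: "vector_norm nu"
    and x: "mc_fragments nu x x1 x2" and y: "mc_fragments nu y y1 y2"
    and disj: "inf (nu x) (nu y) = 0"
  shows "mc_fragments nu (x + y) (x1 + y1) (x2 + y2)"
proof -
  have nn: "0 \<le> nu z" "nu (z + z') \<le> nu z + nu z'" for z z'
    using nu unfolding vector_norm_def by auto
  have le: "nu x1 \<le> nu x" "nu x2 \<le> nu x" "nu y1 \<le> nu y" "nu y2 \<le> nu y"
    using x y by (auto simp: mc_fragments_def fragment_def)
  have "inf (nu x1) (nu y2) = 0" "inf (nu y1) (nu x2) = 0"
    using disjoint_mono[OF disj, of "nu x1" "nu y2"] disjoint_mono[OF disj, of "nu x2" "nu y1"] le nn
    by (simp_all add: inf_commute)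
  then have "inf (nu x1 + nu y1) (nu x2) = 0" "inf (nu x1 + nu y1) (nu y2) = 0"
    using mc_fragments_disjoint[OF x] mc_fragments_disjoint[OF y] by (simp_all add: disjoint_add)
  then have "inf (nu x1 + nu y1) (nu x2 + nu y2) = 0"
    using disjoint_add[of "nu x2" "nu x1 + nu y1" "nu y2"] by (simp add: inf_commute)
  then have "inf (nu (x1 + y1)) (nu (x2 + y2)) = 0"
    by (rule disjoint_mono) (rule nn)+
  then have "mc_fragments nu ((x1 + y1) + (x2 + y2)) (x1 + y1) (x2 + y2)"
    by (rule mc_fragmentsI[OF nu])
  moreover have "(x1 + y1) + (x2 + y2) = x + y"
    using x y by (simp add: mc_fragments_def algebra_simps)
  ultimately show ?thesis by simp
qed

lemma decomposable_sum:
  assumes "decomposable nu" "finite J" "\<And>d. d \<in> J \<Longrightarrow> 0 \<le> d" "0 \<le> r" "nu v = \<Sum>J + r"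
  shows "\<exists>w. (\<forall>d\<in>J. nu (w d) = d) \<and> nu (v - sum w J) = r"
  using assms(2,3,5)
proof (induction J arbitrary: v)
  case (insert d J)
  have "nu v = d + (\<Sum>J + r)" "0 \<le> \<Sum>J + r"
    using insert assms(4) sum_nonneg[of J "\<lambda>d. d"] by (auto simp: add.assoc)
  then obtain x y where xy: "v = x + y" "nu x = d" "nu y = \<Sum>J + r"
    using assms(1) insert.prems unfolding decomposable_def by (metis insertI1)
  obtain w where w: "\<forall>d\<in>J. nu (w d) = d" "nu (y - sum w J) = r"
    using insert.IH[OF _ xy(3)] insert.prems by auto
  have "sum (w(d := x)) J = sum w J" using insert by (intro sum.cong) auto
  then have "v - sum (w(d := x)) (insert d J) = y - sum w J" using insert xy by simp
  then show ?case using w xy(2) insert.hyps by (intro exI[of _ "w(d := x)"]) auto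
qed simp

section \<open>Balancing finitely many functionals\<close>

text \<open>
  The halves of each summand can be exchanged. On \<open>F\<close> the errors add up whatever the choices, so they
  are made small enough in advance, halving the tolerance with each summand. For \<open>t\<^sub>0\<close>, given two
  numbers in \<open>[-\<delta>, \<delta>]\<close>, either their sum or their difference is again in \<open>[-\<delta>, \<delta>]\<close>, so the bound
  \<open>\<delta>\<close> for one summand survives for all of them.
\<close>

lemma balanced_sum:
  fixes nu :: "'v::real_vector \<Rightarrow> 'e::{ordered_real_vector,lattice}"
    and f :: "'g \<Rightarrow> 'v \<Rightarrow> real"
  assumes nu: "vector_norm nu" and f: "\<And>t. linear (f t)"
    and "finite J" and "pairwise (\<lambda>i j. inf (nu (w i)) (nu (w j)) = 0) J"
    and "\<And>i \<eta>. i \<in> J \<Longrightarrow> 0 < \<eta> \<Longrightarrow>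
           \<exists>a b. mc_fragments nu (w i) a b \<and> (\<forall>t\<in>F. \<bar>f t (a - b)\<bar> < \<eta>)"
    and "\<And>i a b. i \<in> J \<Longrightarrow> mc_fragments nu (w i) a b \<Longrightarrow> \<bar>f t\<^sub>0 (a - b)\<bar> \<le> \<delta>"
    and "0 \<le> \<delta>" and "0 < \<eta>"
  shows "\<exists>a b. mc_fragments nu (sum w J) a b \<and> (\<forall>t\<in>F. \<bar>f t (a - b)\<bar> < \<eta>) \<and> \<bar>f t\<^sub>0 (a - b)\<bar> \<le> \<delta>"
  using assms(3-6,8)
proof (induction J arbitrary: \<eta>)
  case empty
  have "mc_fragments nu 0 0 0" "f t 0 = 0" for t
    using nu linear_0[OF f] by (auto simp: mc_fragments_def fragment_def disjoint_wrt_def vector_norm_def)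
  then show ?case using assms(7) empty by (intro exI[of _ 0]) auto
next
  case (insert i J)
  have "\<exists>a b. mc_fragments nu (sum w J) a b \<and> (\<forall>t\<in>F. \<bar>f t (a - b)\<bar> < \<eta> / 2) \<and> \<bar>f t\<^sub>0 (a - b)\<bar> \<le> \<delta>"
  proof (rule insert.IH)
    show "pairwise (\<lambda>i j. inf (nu (w i)) (nu (w j)) = 0) J"
      using insert.prems(1) by (simp add: pairwise_insert)
    show "0 < \<eta> / 2" using insert.prems(4) by simp
  qed (use insert.prems(2,3) in blast)+
  then obtain a b where ab: "mc_fragments nu (sum w J) a b" "\<bar>f t\<^sub>0 (a - b)\<bar> \<le> \<delta>"
      "\<And>t. t \<in> F \<Longrightarrow> \<bar>f t (a - b)\<bar> < \<eta> / 2" by blast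
  obtain c d where cd: "mc_fragments nu (w i) c d" "\<And>t. t \<in> F \<Longrightarrow> \<bar>f t (c - d)\<bar> < \<eta> / 2"
    using insert.prems(2)[of i "\<eta> / 2"] insert.prems(4) by auto
  have cd0: "\<bar>f t\<^sub>0 (c - d)\<bar> \<le> \<delta>" using insert.prems(3) cd(1) by blast
  have disj: "inf (nu (w i)) (nu (sum w J)) = 0"
  proof -
    have nn: "0 \<le> nu z" for z using nu by (simp add: vector_norm_def)
    have "inf (\<Sum>j\<in>J. nu (w j)) (nu (w i)) = 0"
      using insert.prems(1) insert.hyps nn by (intro disjoint_sum) (auto simp: pairwise_insert)
    then show ?thesis
      using disjoint_mono[OF _ nn vector_norm_sum_le[OF nu] nn order_refl] by (simp add: inf_commute)
  qed
  have lin: "f t (x + y - (x' + y')) = f t (x - x') + f t (y - y')" for t x x' y y'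
    using linear_add[OF f, of t "x - x'" "y - y'"] by (simp add: algebra_simps)
  have swap: "f t (d - c) = - f t (c - d)" for t
    using linear_neg[OF f, of t "c - d"] by simp
  have tri: "\<bar>f t (c - d) + f t (a - b)\<bar> < \<eta>" "\<bar>- f t (c - d) + f t (a - b)\<bar> < \<eta>" if "t \<in> F" for t
    using ab(3)[OF that] cd(2)[OF that] by linarith+
  \<comment> \<open>One of the two ways of attaching the halves \<open>c\<close>, \<open>d\<close> to \<open>a\<close>, \<open>b\<close> keeps the bound at \<open>t\<^sub>0\<close>.\<close>
  have "\<bar>f t\<^sub>0 (c - d) + f t\<^sub>0 (a - b)\<bar> \<le> \<delta> \<or> \<bar>- f t\<^sub>0 (c - d) + f t\<^sub>0 (a - b)\<bar> \<le> \<delta>"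
    using ab(2) cd0 by linarith
  then show ?case
  proof
    assume "\<bar>f t\<^sub>0 (c - d) + f t\<^sub>0 (a - b)\<bar> \<le> \<delta>"
    then show ?thesis
      using mc_fragments_add[OF nu cd(1) ab(1) disj] insert.hyps tri(1)
      by (intro exI[of _ "c + a"] exI[of _ "d + b"]) (auto simp: lin)
  next
    assume "\<bar>- f t\<^sub>0 (c - d) + f t\<^sub>0 (a - b)\<bar> \<le> \<delta>"
    then show ?thesis
      using mc_fragments_add[OF nu mc_fragments_swap[OF cd(1)] ab(1) disj] insert.hyps tri(2)
      by (intro exI[of _ "d + a"] exI[of _ "c + b"]) (auto simp: lin swap)
  qed
qed

text \<open>
  The finite-dimensional core. The functionals \<open>s t\<close> dominate the \<open>f t\<close> and make small components
  available; the order continuity of \<open>f t\<close> enters as the existence, in every net that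
  (bo)-converges to \<open>0\<close>, of a term of small value. The nets are indexed by sets of elements of \<open>'e\<close> because they arise
  from the finite subfamilies of an exhausting family of components.
\<close>

lemma balanced_fragments:
  fixes nu :: "'v::real_vector \<Rightarrow> 'e::{ordered_real_vector,conditionally_complete_lattice}"
    and f :: "'g \<Rightarrow> 'v \<Rightarrow> real" and s :: "'g \<Rightarrow> 'e \<Rightarrow> real"
  assumes atomless: "atomless TYPE('e)"
    and nu: "vector_norm nu" and dec: "decomposable nu"
    and f: "\<And>t. linear (f t)" and s: "\<And>t. linear (s t)"
    and s_pos: "\<And>t x. 0 \<le> x \<Longrightarrow> 0 \<le> s t x" and dom: "\<And>t v. \<bar>f t v\<bar> \<le> s t (nu v)"
    and cont: "\<And>t (D :: 'e set set) le x \<eta>. directed_set D le \<Longrightarrow> bo_converges nu D le x 0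
                 \<Longrightarrow> 0 < \<eta> \<Longrightarrow> \<exists>a\<in>D. \<bar>f t (x a)\<bar> < \<eta>"
    and "finite F" and "0 < \<epsilon>"
  shows "\<exists>a b. mc_fragments nu v a b \<and> (\<forall>t\<in>F. \<bar>f t (a - b)\<bar> < \<epsilon>)"
  using assms(9,10)
proof (induction F arbitrary: v \<epsilon>)
  case empty
  have "mc_fragments nu (v + 0) v 0"
    using nu by (intro mc_fragmentsI) (auto simp: vector_norm_zero inf_absorb2 vector_norm_def)
  then show ?case by auto
next
  case (insert t\<^sub>0 F)
  have nn: "0 \<le> nu z" for z using nu by (simp add: vector_norm_def)
  have s_mono: "s t x \<le> s t y" if "x \<le> y" for t x y
    using s_pos[of "y - x" t] that by (simp add: linear_diff[OF s])
  have small_exists: "\<exists>d. component d u \<and> 0 < d \<and> s t\<^sub>0 d \<le> \<epsilon> / 2" if "0 < u" for u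
    using component_small[OF atomless that s s_pos, of "\<epsilon> / 2" t\<^sub>0] insert.prems by simp
  obtain A where A: "\<And>d. d \<in> A \<Longrightarrow> component d (nu v) \<and> s t\<^sub>0 d \<le> \<epsilon> / 2"
    and disj: "pairwise (\<lambda>c d. inf c d = 0) A"
    and zero: "decreasing_to_zero {J. finite J \<and> J \<subseteq> A} (\<subseteq>) (\<lambda>J. nu v - \<Sum>J)"
  proof (rule component_exhaustion[OF nn[of v], where P = "\<lambda>d. s t\<^sub>0 d \<le> \<epsilon> / 2"])
    show "\<exists>d. component d u \<and> 0 < d \<and> s t\<^sub>0 d \<le> \<epsilon> / 2" if "0 < u" for u
      using that by (rule small_exists)
  qed (rule that; (assumption | blast))
  let ?G = "{J. finite J \<and> J \<subseteq> A}"
  \<comment> \<open>For every finite \<open>J\<close>: pieces \<open>w d\<close> of \<open>v\<close> along \<open>J\<close>, and a splitting \<open>a\<close>, \<open>b\<close> of the remainder.\<close>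
  define Q where "Q J w a b \<longleftrightarrow>
      (\<forall>d\<in>J. nu (w d) = d) \<and> nu (v - sum w J) = nu v - \<Sum>J \<and>
      mc_fragments nu (v - sum w J) a b \<and> (\<forall>t\<in>F. \<bar>f t (a - b)\<bar> < \<epsilon> / 2)" for J w a b
  have "\<exists>w a b. Q J w a b" if "J \<in> ?G" for J
  proof -
    have "\<exists>w. (\<forall>d\<in>J. nu (w d) = d) \<and> nu (v - sum w J) = nu v - \<Sum>J"
      using that A zero
      by (intro decomposable_sum[OF dec]) (auto simp: component_def decreasing_to_zero_def)
    then show ?thesis unfolding Q_def using insert.IH[of "\<epsilon> / 2"] insert.prems by (meson half_gt_zero)
  qed
  then obtain w a b where Q: "\<And>J. J \<in> ?G \<Longrightarrow> Q J (w J) (a J) (b J)" by metis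
  have w: "d \<in> J \<Longrightarrow> nu (w J d) = d"
    and rest: "nu (v - sum (w J) J) = nu v - \<Sum>J"
    and ab: "mc_fragments nu (v - sum (w J) J) (a J) (b J)"
    and abF: "t \<in> F \<Longrightarrow> \<bar>f t (a J - b J)\<bar> < \<epsilon> / 2" if "J \<in> ?G"
    for J d t
    using Q[OF that] unfolding Q_def by blast+
  have dir: "directed_set ?G (\<subseteq>)" using zero by (simp add: decreasing_to_zero_def)
  \<comment> \<open>The halves of the remainder for different \<open>J\<close> are unrelated, but their differences are dominated
      by the remainders of \<open>nu v\<close>, which suffices for convergence.\<close>
  have "bo_converges nu ?G (\<subseteq>) (\<lambda>J. b J - a J) 0"
  proof (rule bo_convergesI[OF zero], rule ballI)
    fix J assume "J \<in> ?G"
    have "nu (0 - (b K - a K)) \<le> nu v - \<Sum>J" if "K \<in> ?G" "J \<subseteq> K" for K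
      using mc_fragments_diff_le[OF nu ab[OF that(1)]] rest[OF that(1)] zero that \<open>J \<in> ?G\<close>
      unfolding decreasing_to_zero_def by (simp, meson order_trans)
    then show "\<exists>J'\<in>?G. \<forall>K\<in>?G. J' \<subseteq> K \<longrightarrow> nu (0 - (b K - a K)) \<le> nu v - \<Sum>J"
      using \<open>J \<in> ?G\<close> by blast
  qed
  then obtain J where J: "J \<in> ?G" and "\<bar>f t\<^sub>0 (b J - a J)\<bar> < \<epsilon> / 2"
    using cont[OF dir, of _ "\<epsilon> / 2" t\<^sub>0] insert.prems by auto
  then have ab0: "\<bar>f t\<^sub>0 (a J - b J)\<bar> < \<epsilon> / 2"
    using linear_neg[OF f, of t\<^sub>0 "b J - a J"] by simp
  have "\<exists>p q. mc_fragments nu (sum (w J) J) p q \<and> (\<forall>t\<in>F. \<bar>f t (p - q)\<bar> < \<epsilon> / 2) \<and>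
          \<bar>f t\<^sub>0 (p - q)\<bar> \<le> \<epsilon> / 2"
  proof (rule balanced_sum[OF nu f])
    show "finite J" using J by simp
    show "pairwise (\<lambda>c d. inf (nu (w J c)) (nu (w J d)) = 0) J"
      using disj J w[OF J] by (auto simp: pairwise_def)
    show "\<exists>a b. mc_fragments nu (w J d) a b \<and> (\<forall>t\<in>F. \<bar>f t (a - b)\<bar> < \<eta>)" if "0 < \<eta>" for d \<eta>
      using insert.IH that by blast
    show "\<bar>f t\<^sub>0 (p - q)\<bar> \<le> \<epsilon> / 2" if "d \<in> J" "mc_fragments nu (w J d) p q" for d p q
    proof -
      have "s t\<^sub>0 (nu (p - q)) \<le> s t\<^sub>0 d"
        using mc_fragments_diff_le[OF nu that(2)] w[OF J that(1)] by (intro s_mono) simp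
      then show ?thesis using A[of d] dom[of t\<^sub>0 "p - q"] J that(1) by fastforce
    qed
  qed (use insert.prems in auto)
  then obtain p q where pq: "mc_fragments nu (sum (w J) J) p q" "\<bar>f t\<^sub>0 (p - q)\<bar> \<le> \<epsilon> / 2"
      "\<And>t. t \<in> F \<Longrightarrow> \<bar>f t (p - q)\<bar> < \<epsilon> / 2" by blast
  have "inf (nu (sum (w J) J)) (nu (v - sum (w J) J)) = 0"
  proof -
    have rest_pos: "0 \<le> nu v - \<Sum>J" using zero J by (simp add: decreasing_to_zero_def)
    have "inf (\<Sum>J) (nu v - \<Sum>J) = 0"
    proof (rule disjoint_sum[OF rest_pos])
      fix d assume d: "d \<in> J"
      then have "inf d (nu v - d) = 0" "0 \<le> d" using A J by (auto simp: component_def)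
      moreover have "nu v - \<Sum>J \<le> nu v - d"
      proof (rule diff_left_mono)
        have "0 \<le> c" if "c \<in> J" for c using A[of c] J that by (auto simp: component_def)
        then show "d \<le> \<Sum>J" using sum_mono2[of J "{d}" "\<lambda>x. x"] J d by simp
      qed
      ultimately show "inf d (nu v - \<Sum>J) = 0"
        by (rule disjoint_mono[OF _ _ order_refl rest_pos])
    qed
    moreover have "nu (sum (w J) J) \<le> \<Sum>J"
      using vector_norm_sum_le[OF nu, of "w J" J] w[OF J] by simp
    ultimately show ?thesis
      by (rule disjoint_mono[OF _ nn _ nn order_eq_refl[OF rest[OF J]]])
  qed
  then have "mc_fragments nu v (p + a J) (q + b J)"
    using mc_fragments_add[OF nu pq(1) ab[OF J]] by simp
  moreover have "f t (p + a J - (q + b J)) = f t (p - q) + f t (a J - b J)" for t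
    using linear_add[OF f, of t "p - q" "a J - b J"] by (simp add: algebra_simps)
  then have "\<bar>f t (p + a J - (q + b J))\<bar> < \<epsilon>" if "t \<in> insert t\<^sub>0 F" for t
    using that pq(2) pq(3)[of t] ab0 abF[OF J, of t] by auto
  ultimately show ?case by blast
qed

section \<open>Coordinates in the sequence spaces\<close>

lemma c0_space_finite: "x \<in> c0_space \<Gamma> \<Longrightarrow> 0 < \<epsilon> \<Longrightarrow> finite {t\<in>\<Gamma>. \<epsilon> \<le> \<bar>x t\<bar>}"
  by (simp add: c0_space_def)

lemma c0_space_bdd: "x \<in> c0_space \<Gamma> \<Longrightarrow> bdd_above (range (\<lambda>t. \<bar>x t\<bar>))"
proof -
  assume x: "x \<in> c0_space \<Gamma>"
  let ?F = "{t\<in>\<Gamma>. 1 \<le> \<bar>x t\<bar>}"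
  have fin: "finite ?F" using x by (simp add: c0_space_def)
  have "\<bar>x t\<bar> \<le> 1 + (\<Sum>t\<in>?F. \<bar>x t\<bar>)" for t
  proof (cases "t \<in> ?F")
    case True
    then show ?thesis using member_le_sum[of t ?F "\<lambda>t. \<bar>x t\<bar>"] fin by simp
  next
    case False
    then have "\<bar>x t\<bar> \<le> 1" using x by (cases "t \<in> \<Gamma>") (auto simp: c0_space_def)
    then show ?thesis using sum_nonneg[of ?F "\<lambda>t. \<bar>x t\<bar>"] by linarith
  qed
  then show ?thesis by (intro bdd_aboveI2)
qed

lemma lp_space_summable:
  assumes "x \<in> lp_space p \<Gamma>"
  shows "(\<lambda>t. \<bar>x t\<bar> powr p) summable_on UNIV"
proof -
  have "(\<lambda>t. \<bar>x t\<bar> powr p) summable_on \<Gamma> \<longleftrightarrow> (\<lambda>t. \<bar>x t\<bar> powr p) summable_on UNIV"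
    using assms by (intro summable_on_cong_neutral) (auto simp: lp_space_def)
  then show ?thesis using assms by (simp add: lp_space_def)
qed

lemma c0_norm_ge: "x \<in> c0_space \<Gamma> \<Longrightarrow> \<bar>x t\<bar> \<le> c0_norm x"
  unfolding c0_norm_def by (intro cSUP_upper c0_space_bdd) auto

lemma lp_norm_ge:
  assumes "1 \<le> p" "x \<in> lp_space p \<Gamma>"
  shows "\<bar>x t\<bar> \<le> lp_norm p x"
proof -
  have "(\<Sum>\<^sub>\<infinity>t\<in>{t}. \<bar>x t\<bar> powr p) \<le> (\<Sum>\<^sub>\<infinity>t. \<bar>x t\<bar> powr p)"
    by (rule infsum_mono_neutral) (auto intro: lp_space_summable[OF assms(2)])
  then have "(\<bar>x t\<bar> powr p) powr (1 / p) \<le> lp_norm p x"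
    unfolding lp_norm_def using assms by (intro powr_mono2) auto
  then show ?thesis using assms by (simp add: powr_powr)
qed

lemma c0_space_diff:
  assumes "x \<in> c0_space \<Gamma>" "y \<in> c0_space \<Gamma>"
  shows "x - y \<in> c0_space \<Gamma>"
proof -
  have "finite {t\<in>\<Gamma>. \<epsilon> \<le> \<bar>(x - y) t\<bar>}" if "0 < \<epsilon>" for \<epsilon>
  proof (rule finite_subset)
    show "{t\<in>\<Gamma>. \<epsilon> \<le> \<bar>(x - y) t\<bar>} \<subseteq> {t\<in>\<Gamma>. \<epsilon> / 2 \<le> \<bar>x t\<bar>} \<union> {t\<in>\<Gamma>. \<epsilon> / 2 \<le> \<bar>y t\<bar>}"
      by auto
    show "finite ({t\<in>\<Gamma>. \<epsilon> / 2 \<le> \<bar>x t\<bar>} \<union> {t\<in>\<Gamma>. \<epsilon> / 2 \<le> \<bar>y t\<bar>})"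
      using c0_space_finite[OF assms(1), of "\<epsilon> / 2"] c0_space_finite[OF assms(2), of "\<epsilon> / 2"] that by simp
  qed
  then show ?thesis using assms by (simp add: c0_space_def)
qed

text \<open>
  Minkowski's inequality is replaced by the crude bound
  \<open>|a - b|\<^sup>p \<le> 2\<^sup>p (|a|\<^sup>p + |b|\<^sup>p)\<close>, which suffices for summability.
\<close>

lemma lp_space_diff:
  assumes "1 \<le> p" "x \<in> lp_space p \<Gamma>" "y \<in> lp_space p \<Gamma>"
  shows "x - y \<in> lp_space p \<Gamma>"
proof -
  have bound: "\<bar>a - b\<bar> powr p \<le> 2 powr p * (\<bar>a\<bar> powr p + \<bar>b\<bar> powr p)" for a b :: real
  proof -
    have "\<bar>a - b\<bar> powr p \<le> (2 * max \<bar>a\<bar> \<bar>b\<bar>) powr p"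
      using assms(1) by (intro powr_mono2) auto
    also have "\<dots> = 2 powr p * max \<bar>a\<bar> \<bar>b\<bar> powr p" by (simp add: powr_mult)
    also have "\<dots> \<le> 2 powr p * (\<bar>a\<bar> powr p + \<bar>b\<bar> powr p)"
      by (intro mult_left_mono) (auto simp: max_def)
    finally show ?thesis .
  qed
  have "(\<lambda>t. 2 powr p * (\<bar>x t\<bar> powr p + \<bar>y t\<bar> powr p)) summable_on \<Gamma>"
    using assms by (intro summable_on_cmult_right summable_on_add) (auto simp: lp_space_def)
  then have "(\<lambda>t. \<bar>(x - y) t\<bar> powr p) summable_on \<Gamma>"
    by (rule summable_on_comparison_test) (use bound in auto)
  then show ?thesis using assms by (simp add: lp_space_def)
qed

text \<open>Outside a finite set of coordinates \<open>g\<close>, and with it \<open>y\<close>, already stays below \<open>\<epsilon> / 2\<close>.\<close>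

lemma c0_norm_small:
  assumes g: "g \<in> c0_space \<Gamma>" and "0 < \<epsilon>"
  shows "\<exists>F \<delta>. finite F \<and> 0 < \<delta> \<and>
           (\<forall>y. (\<forall>t. \<bar>y t\<bar> \<le> g t) \<and> (\<forall>t\<in>F. \<bar>y t\<bar> < \<delta>) \<longrightarrow> c0_norm y < \<epsilon>)"
proof (intro exI conjI allI impI)
  let ?F = "{t\<in>\<Gamma>. \<epsilon> / 2 \<le> \<bar>g t\<bar>}"
  show "finite ?F" "0 < \<epsilon> / 2" using c0_space_finite[OF g, of "\<epsilon> / 2"] assms(2) by simp_all
  fix y assume y: "(\<forall>t. \<bar>y t\<bar> \<le> g t) \<and> (\<forall>t\<in>?F. \<bar>y t\<bar> < \<epsilon> / 2)"
  have "\<bar>y t\<bar> \<le> \<epsilon> / 2" for t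
  proof (cases "t \<in> ?F")
    case False
    then have "\<bar>g t\<bar> \<le> \<epsilon> / 2" using assms by (cases "t \<in> \<Gamma>") (auto simp: c0_space_def)
    then show ?thesis using y by (meson abs_ge_self order_trans)
  qed (use y in \<open>auto intro: less_imp_le\<close>)
  then have "c0_norm y \<le> \<epsilon> / 2" unfolding c0_norm_def by (intro cSUP_least) auto
  then show "c0_norm y < \<epsilon>" using assms(2) by simp
qed

text \<open>
  Of the sum of the \<open>|y t|\<^sup>p\<close>, which has to stay below \<open>2 * \<alpha> = \<epsilon>\<^sup>p\<close>, the coordinates in \<open>F\<close>
  contribute at most \<open>\<alpha>\<close> by the choice of \<open>\<delta>\<close>, and the others at most the tail \<open>\<alpha> / 2\<close> of the
  series for \<open>g\<close>.
\<close>

lemma lp_norm_small: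
  assumes p: "1 \<le> p" and g: "g \<in> lp_space p \<Gamma>" and "0 < \<epsilon>"
  shows "\<exists>F \<delta>. finite F \<and> 0 < \<delta> \<and>
           (\<forall>y. (\<forall>t. \<bar>y t\<bar> \<le> g t) \<and> (\<forall>t\<in>F. \<bar>y t\<bar> < \<delta>) \<longrightarrow> lp_norm p y < \<epsilon>)"
proof -
  define h where "h = (\<lambda>t. \<bar>g t\<bar> powr p)"
  define \<alpha> where "\<alpha> = \<epsilon> powr p / 2"
  have \<alpha>: "0 < \<alpha>" using assms(3) by (simp add: \<alpha>_def)
  have h: "h summable_on UNIV" unfolding h_def by (rule lp_space_summable[OF g])
  obtain F where F: "finite F" "infsum h UNIV - sum h F \<le> \<alpha> / 2"
  proof -
    obtain F where "finite F" "dist (sum h F) (infsum h UNIV) \<le> \<alpha> / 2"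
      using infsum_finite_approximation[OF h, of "\<alpha> / 2"] \<alpha> by auto
    moreover from this have "infsum h UNIV - sum h F \<le> \<alpha> / 2" unfolding dist_real_def by linarith
    ultimately show ?thesis using that by blast
  qed
  define \<delta> where "\<delta> = (\<alpha> / (card F + 1)) powr (1 / p)"
  have \<delta>: "0 < \<delta>" "\<delta> powr p = \<alpha> / (card F + 1)"
    using \<alpha> p by (auto simp: \<delta>_def powr_powr)
  have "lp_norm p y < \<epsilon>" if y: "\<forall>t. \<bar>y t\<bar> \<le> g t" "\<forall>t\<in>F. \<bar>y t\<bar> < \<delta>" for y
  proof -
    let ?k = "\<lambda>t. \<bar>y t\<bar> powr p"
    have kh: "?k t \<le> h t" for t
      unfolding h_def using y(1) p by (intro powr_mono2) (auto intro: order_trans)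
    have k: "?k summable_on UNIV"
      by (rule summable_on_comparison_test[OF h]) (use kh in auto)
    have split: "infsum q UNIV = sum q F + infsum q (- F)" if "q summable_on UNIV" for q :: "_ \<Rightarrow> real"
      using infsum_Un_disjoint[of q F "- F"] that F(1)
      by (auto intro: summable_on_subset_banach)
    have "infsum ?k (- F) \<le> infsum h (- F)"
      by (rule infsum_mono) (use k h kh in \<open>auto intro: summable_on_subset_banach\<close>)
    also have "\<dots> \<le> \<alpha> / 2" using split[OF h] F(2) by simp
    finally have tail: "infsum ?k (- F) \<le> \<alpha> / 2" .
    have "sum ?k F \<le> (\<Sum>t\<in>F. \<delta> powr p)"
      using y(2) p by (intro sum_mono powr_mono2) (auto intro: less_imp_le)
    also have "\<dots> \<le> \<alpha>" using \<alpha> by (simp add: \<delta>(2) field_simps)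
    finally have "infsum ?k UNIV < \<epsilon> powr p"
      using split[OF k] tail \<alpha> unfolding \<alpha>_def by linarith
    then have "lp_norm p y < (\<epsilon> powr p) powr (1 / p)"
      unfolding lp_norm_def using p by (intro powr_less_mono2) (auto intro: infsum_nonneg)
    then show ?thesis using p assms(3) by (simp add: powr_powr)
  qed
  then show ?thesis using F(1) \<delta>(1) by blast
qed

text \<open>
  Order-to-norm continuity provides some limit \<open>l\<close> of the images, not that it is \<open>0\<close>. Interleaving
  the net with the constant net \<open>0\<close> gives a net that still (bo)-converges to \<open>0\<close>; the images of both
  parts have to be close to the same \<open>l\<close>, hence to each other.
\<close>

lemma order_to_norm_continuous_coordinate:
  fixes nu :: "'v::real_vector \<Rightarrow> 'e::{ordered_real_vector,lattice}" and T :: "'v::real_vector \<Rightarrow> 'g \<Rightarrow> real"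
  assumes T: "order_to_norm_continuous nu X nX T" "linear T" "range T \<subseteq> X" and nu: "vector_norm nu"
    and coord: "\<And>x y. x \<in> X \<Longrightarrow> y \<in> X \<Longrightarrow> \<bar>(x - y) t\<bar> \<le> nX (x - y)"
    and D: "directed_set D le" "bo_converges nu D le x 0" and "0 < \<eta>"
  shows "\<exists>a\<in>D. \<bar>T (x a) t\<bar> < \<eta>"
proof -
  let ?D = "D \<times> (UNIV :: bool set)" and ?le = "\<lambda>p q. le (fst p) (fst q)"
    and ?x = "\<lambda>p. if snd p then x (fst p) else 0"
  have refl: "le a a" if "a \<in> D" for a
    using D(1) that by (simp add: directed_set_def reflp_on_def)
  have "directed_set ?D ?le"
    unfolding directed_set_def
  proof (intro conjI ballI)
    show "?D \<noteq> {}" using D(1) by (auto simp: directed_set_def)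
    show "reflp_on ?D ?le" using refl by (auto simp: reflp_on_def)
    show "transp_on ?D ?le"
      using D(1) unfolding directed_set_def by (auto intro!: transp_onI dest: transp_onD)
    show "\<exists>r\<in>?D. ?le p r \<and> ?le q r" if pq: "p \<in> ?D" "q \<in> ?D" for p q
    proof -
      obtain c where "c \<in> D" "le (fst p) c" "le (fst q) c"
        using D(1) pq unfolding directed_set_def mem_Times_iff by meson
      then show ?thesis by (intro bexI[of _ "(c, True)"]) auto
    qed
  qed
  moreover have "bo_converges nu ?D ?le ?x 0"
  proof -
    obtain G leG and e :: "'e \<Rightarrow> 'e" where e: "decreasing_to_zero G leG e"
      and le: "\<forall>c\<in>G. \<exists>a\<in>D. \<forall>b\<in>D. le a b \<longrightarrow> nu (0 - x b) \<le> e c"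
      using D(2) unfolding bo_converges_def by blast
    show ?thesis
    proof (rule bo_convergesI[OF e], rule ballI)
      fix c assume c: "c \<in> G"
      then obtain a where a: "a \<in> D" "\<And>b. b \<in> D \<Longrightarrow> le a b \<Longrightarrow> nu (0 - x b) \<le> e c"
        using le by blast
      have "nu 0 \<le> e c" using vector_norm_zero[OF nu] e c by (simp add: decreasing_to_zero_def)
      then show "\<exists>a\<in>?D. \<forall>b\<in>?D. ?le a b \<longrightarrow> nu (0 - ?x b) \<le> e c"
        using a by (intro bexI[of _ "(a, True)"]) auto
    qed
  qed
  ultimately obtain l where l: "l \<in> X" "net_norm_converges nX ?D ?le (\<lambda>p. T (?x p)) l"
    using order_to_norm_continuousD[OF T(1)] by blast
  obtain a0 where "a0 \<in> ?D" and a0: "\<forall>b\<in>?D. ?le a0 b \<longrightarrow> nX (T (?x b) - l) < \<eta> / 2"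
    using l(2) \<open>0 < \<eta>\<close> unfolding net_norm_converges_def by (meson half_gt_zero)
  define a where "a = fst a0"
  have a: "a \<in> D" using \<open>a0 \<in> ?D\<close> by (auto simp: a_def)
  have "nX (T (x a) - l) < \<eta> / 2" "nX (T 0 - l) < \<eta> / 2"
    using bspec[OF a0, of "(a, True)"] bspec[OF a0, of "(a, False)"] refl[OF a] a
    by (auto simp: a_def)
  moreover have "\<bar>(T z - l) t\<bar> \<le> nX (T z - l)" for z using coord T(3) l(1) by blast
  ultimately have "\<bar>(T (x a) - l) t\<bar> < \<eta> / 2" "\<bar>(T 0 - l) t\<bar> < \<eta> / 2" by (meson order_le_less_trans)+
  then have "\<bar>T (x a) t - l t\<bar> < \<eta> / 2" "\<bar>l t\<bar> < \<eta> / 2" using linear_0[OF T(2)] by simp_all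
  then have "\<bar>T (x a) t\<bar> < \<eta>" by linarith
  then show ?thesis using a by blast
qed

theorem theorem3:
  fixes nu :: "'v::real_vector \<Rightarrow> 'e::{ordered_real_vector,conditionally_complete_lattice}"
    and \<Gamma> :: "'g set"
    and X :: "('g \<Rightarrow> real) set"
    and nX :: "('g \<Rightarrow> real) \<Rightarrow> real"
    and T :: "'v \<Rightarrow> 'g \<Rightarrow> real"
  assumes "atomless TYPE('e)"
    and "banach_kantorovich nu"
    and "(X = c0_space \<Gamma> \<and> nX = c0_norm) \<or> (\<exists>p\<ge>1. X = lp_space p \<Gamma> \<and> nX = lp_norm p)"
    and "linear T" and "range T \<subseteq> X"
    and "order_to_norm_continuous nu X nX T"
    and "dominated nu modulus X T"
  shows "narrow nu nX T"
proof -
  have nu: "vector_norm nu" and dec: "decomposable nu"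
    using assms(2) by (auto simp: banach_kantorovich_def)
  obtain S where S: "linear S" "range S \<subseteq> X" "\<And>e. 0 \<le> e \<Longrightarrow> 0 \<le> S e"
    and TS: "\<And>v. modulus (T v) \<le> S (nu v)"
    using assms(7) unfolding dominated_def by blast
  have S_mono: "S x t \<le> S y t" if "x \<le> y" for x y t
    using S(3)[of "y - x"] that linear_diff[OF S(1), of y x] by (simp add: le_fun_def)
  have dom: "\<bar>T v t\<bar> \<le> S (nu v) t" for v t
    using TS[of v] by (auto simp: modulus_def le_fun_def abs_le_iff)
  have coordinate: "linear (\<lambda>v. R v t)" if "linear R" for R :: "'x::real_vector \<Rightarrow> 'g \<Rightarrow> real" and t
    using linear_add[OF that] linear_scale[OF that] by (intro linearI) (auto simp: scaleR_fun_def)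
  have coord: "\<bar>(x - y) t\<bar> \<le> nX (x - y)" if "x \<in> X" "y \<in> X" for x y t
    using assms(3) c0_norm_ge[OF c0_space_diff[of x \<Gamma> y], of t] that
      lp_norm_ge[OF _ lp_space_diff[of _ x \<Gamma> y], of _ t] by blast
  have small: "\<exists>F \<delta>. finite F \<and> 0 < \<delta> \<and>
      (\<forall>y. (\<forall>t. \<bar>y t\<bar> \<le> g t) \<and> (\<forall>t\<in>F. \<bar>y t\<bar> < \<delta>) \<longrightarrow> nX y < \<epsilon>)" if "g \<in> X" "0 < \<epsilon>" for g \<epsilon>
    using assms(3)
  proof (elim disjE exE conjE)
    assume "X = c0_space \<Gamma>" "nX = c0_norm"
    then show ?thesis using c0_norm_small[of g \<Gamma> \<epsilon>] that by simp
  next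
    fix p :: real assume "1 \<le> p" "X = lp_space p \<Gamma>" "nX = lp_norm p"
    then show ?thesis using lp_norm_small[of p g \<Gamma> \<epsilon>] that by simp
  qed
  show ?thesis
    unfolding narrow_def
  proof (intro allI impI)
    fix v and \<epsilon> :: real assume "0 < \<epsilon>"
    have "S (nu v) \<in> X" using S(2) by blast
    then obtain F \<delta> where F: "finite F" "0 < \<delta>"
      and norm_small: "\<And>y. (\<And>t. \<bar>y t\<bar> \<le> S (nu v) t) \<Longrightarrow> (\<And>t. t \<in> F \<Longrightarrow> \<bar>y t\<bar> < \<delta>) \<Longrightarrow> nX y < \<epsilon>"
      using small[OF _ \<open>0 < \<epsilon>\<close>] by metis
    have "\<exists>a b. mc_fragments nu v a b \<and> (\<forall>t\<in>F. \<bar>T (a - b) t\<bar> < \<delta>)"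
    proof (rule balanced_fragments[where f = "\<lambda>t v. T v t" and s = "\<lambda>t e. S e t"])
      show "0 \<le> S e t" if "0 \<le> e" for e t using S(3)[OF that] by (simp add: le_fun_def)
      show "\<exists>a\<in>D. \<bar>T (x a) t\<bar> < \<eta>"
        if "directed_set D le" "bo_converges nu D le x 0" "0 < \<eta>"
        for t \<eta> le x and D :: "'e set set"
        using assms(6,4,5) nu coord that by (rule order_to_norm_continuous_coordinate)
    qed (use assms(1) nu dec F in \<open>simp_all add: coordinate[OF assms(4)] coordinate[OF S(1)] dom\<close>)
    then obtain a b where ab: "mc_fragments nu v a b" "\<And>t. t \<in> F \<Longrightarrow> \<bar>T (a - b) t\<bar> < \<delta>"
      by blast
    have "\<bar>T (a - b) t\<bar> \<le> S (nu v) t" for t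
      using dom[of "a - b" t] S_mono[OF mc_fragments_diff_le[OF nu ab(1)], of t] by linarith
    then have "nX (T (a - b)) < \<epsilon>" using ab(2) by (rule norm_small)
    then show "\<exists>a b. mc_fragments nu v a b \<and> nX (T a - T b) < \<epsilon>"
      using ab(1) linear_diff[OF assms(4), of a b] by auto
  qed
qed

end
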